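(* Let $G$ be a finite non-cyclic group. Then the following conditions are equivalent: (i) the non-cyclic graph $\Gamma(G)$ admits a perfect code; (ii) $\Gamma(G)$ has a dominating vertex; (iii) $G$ has a maximal cyclic subgroup of order $2$.
   Context: For a finite non-cyclic group $G$, $\mathrm{Cyc}(G)=\{x\in G:\langle x,y\rangle\text{ is cyclic for all }y\in G\}$. The non-cyclic graph $\Gamma(G)$ is the simple undirected graph with vertex set $G\setminus\mathrm{Cyc}(G)$ in which two distinct vertices $x,y$ are adjacent if and only if the subgroup $\langle x,y\rangle$ is not cyclic. A perfect code of a graph $\Gamma$ is an independent set $C\subseteq V(\Gamma)$ such that every vertex in $V(\Gamma)\setminus C$ is adjacent to exactly one vertex in $C$. A dominating vertex is a vertex adjacent to all other vertices of the graph. A maximal cyclic subgroup of $G$ is a cyclic subgroup not properly contained in any other cyclic subgroup of $G$. *)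

theory Defs
  imports "HOL-Algebra.Elementary_Groups" "Graph_Theory.Pair_Digraph"
begin

definition Cyc :: "('a, 'b) monoid_scheme \<Rightarrow> 'a set" where
  "Cyc G = {x \<in> carrier G. \<forall>y \<in> carrier G. cyclic_group (subgroup_generated G {x, y})}"

text \<open>
  An undirected graph is represented, as usual in Graph_Theory, by a symmetric digraph:
  the edge between x and y is the pair of arcs (x, y) and (y, x).
\<close>

definition noncyclic_graph :: "('a, 'b) monoid_scheme \<Rightarrow> 'a pair_pre_digraph" where
  "noncyclic_graph G =
    \<lparr> pverts = carrier G - Cyc G,
      parcs = {(x, y). x \<in> carrier G - Cyc G \<and> y \<in> carrier G - Cyc G \<and> x \<noteq> y \<and>
                       \<not> cyclic_group (subgroup_generated G {x, y})} \<rparr>"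

lemma pair_graph_noncyclic_graph:
  assumes "finite (carrier G)"
  shows "pair_graph (noncyclic_graph G)"
proof unfold_locales
  show "finite (parcs (noncyclic_graph G))"
    by (rule finite_subset[of _ "carrier G \<times> carrier G"])
       (auto simp: noncyclic_graph_def assms)
qed (auto simp: noncyclic_graph_def assms symmetric_def sym_def insert_commute)

definition independent_set :: "'a pair_pre_digraph \<Rightarrow> 'a set \<Rightarrow> bool" where
  "independent_set \<Gamma> C \<longleftrightarrow>
    C \<subseteq> pverts \<Gamma> \<and> (\<forall>u \<in> C. \<forall>v \<in> C. (u, v) \<notin> parcs \<Gamma>)"

definition perfect_code :: "'a pair_pre_digraph \<Rightarrow> 'a set \<Rightarrow> bool" where
  "perfect_code \<Gamma> C \<longleftrightarrow>
    independent_set \<Gamma> C \<and> (\<forall>v \<in> pverts \<Gamma> - C. \<exists>!c. c \<in> C \<and> (v, c) \<in> parcs \<Gamma>)"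

definition dominating_vertex :: "'a pair_pre_digraph \<Rightarrow> 'a \<Rightarrow> bool" where
  "dominating_vertex \<Gamma> v \<longleftrightarrow>
    v \<in> pverts \<Gamma> \<and> (\<forall>u \<in> pverts \<Gamma> - {v}. (v, u) \<in> parcs \<Gamma>)"

definition cyclic_subgroup :: "'a set \<Rightarrow> ('a, 'b) monoid_scheme \<Rightarrow> bool" where
  "cyclic_subgroup H G \<longleftrightarrow> subgroup H G \<and> cyclic_group (G\<lparr>carrier := H\<rparr>)"

definition maximal_cyclic_subgroup :: "'a set \<Rightarrow> ('a, 'b) monoid_scheme \<Rightarrow> bool" where
  "maximal_cyclic_subgroup H G \<longleftrightarrow>
    cyclic_subgroup H G \<and> \<not> (\<exists>K. cyclic_subgroup K G \<and> H \<subset> K)"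

end

theory Submission
  imports Defs "HOL-Computational_Algebra.Primes" "HOL-Algebra.Multiplicative_Group"
begin

text \<open>
  Call two elements cocyclic if some cyclic subgroup contains both; adjacency is the failure of this.
  The crux is that three pairwise cocyclic elements \<open>a\<close>, \<open>b\<close>, \<open>c\<close> of a finite group lie in one
  cyclic subgroup. If \<open>a\<close> and \<open>b\<close> generate \<open>\<langle>e\<rangle>\<close>, then \<open>ord e\<close> is the lcm of \<open>ord a\<close> and \<open>ord b\<close>;
  since \<open>\<langle>a\<rangle>\<close> and \<open>\<langle>b\<rangle>\<close> meet \<open>\<langle>c\<rangle>\<close> in subgroups of order \<open>gcd (ord a) (ord c)\<close> and
  \<open>gcd (ord b) (ord c)\<close>, distributivity of gcd over lcm makes the intersection of \<open>\<langle>e\<rangle>\<close> and \<open>\<langle>c\<rangle>\<close> as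
  large as the orders permit, and this forces \<open>e\<close> and \<open>c\<close> to be cocyclic.

  Given two distinct members \<open>c\<close>, \<open>d\<close> of a perfect code, let \<open>e\<close> generate \<open>\<langle>c, d\<rangle>\<close>. If \<open>e\<close> is in the
  code, it competes with \<open>c\<close> and \<open>d\<close> for each of their neighbours; otherwise its neighbour in the
  code is cocyclic with \<open>c\<close> and \<open>d\<close> but not with \<open>e\<close>. Hence a perfect code is a single vertex, and
  this vertex dominates. A dominating vertex is adjacent neither to its inverse nor to a generator of
  a cyclic subgroup containing it, so it is an involution and generates a maximal cyclic subgroup.
\<close>

section \<open>Coprime terms of an arithmetic progression\<close>

lemma ex_coprime_arith_progression:
  fixes a b n :: int
  assumes "n \<noteq> 0" and "gcd n (gcd a b) = 1"
  shows "\<exists>t. coprime n (a + t * b)"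
proof -
  \<comment> \<open>A prime divisor of \<open>n\<close> divides exactly one of \<open>a\<close> and \<open>\<Prod>P * b\<close>.\<close>
  define P where "P = {p. prime p \<and> p dvd n \<and> \<not> p dvd a}"
  have "finite P"
    using finite_divisors_int[OF assms(1)] by (rule finite_subset[rotated]) (auto simp: P_def)
  have "coprime n (a + \<Prod>P * b)"
  proof (rule ccontr)
    assume "\<not> coprime n (a + \<Prod>P * b)"
    then have "\<not> is_unit (gcd n (a + \<Prod>P * b))"
      using coprime_iff_gcd_eq_1 is_unit_gcd by blast
    moreover have "gcd n (a + \<Prod>P * b) \<noteq> 0"
      using assms(1) by simp
    ultimately obtain p where "prime p" "p dvd gcd n (a + \<Prod>P * b)"
      using prime_divisor_exists by blast
    then have p: "prime p" "p dvd n" "p dvd a + \<Prod>P * b"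
      by simp_all
    show False
    proof (cases "p dvd a")
      case True
      then have "p dvd \<Prod>P * b"
        using p(3) by (simp add: dvd_add_right_iff)
      moreover have "\<not> p dvd b"
        using assms(2) p True by (metis gcd_greatest not_prime_unit)
      ultimately have "p dvd \<Prod>P"
        using p(1) prime_dvd_mult_iff by blast
      then obtain q where "q \<in> P" "p dvd q"
        using \<open>finite P\<close> p(1) by (auto simp: prime_dvd_prod_iff)
      then show False
        using True p(1) primes_dvd_imp_eq by (auto simp: P_def)
    next
      case False
      then have "p dvd \<Prod>P * b"
        using p \<open>finite P\<close> by (auto simp: P_def intro!: dvd_mult2 dvd_prodI)
      then show False
        using False p(3) by (simp add: dvd_add_left_iff)
    qed
  qed
  then show ?thesis ..
qed

context group
begin

section \<open>Cyclic subgroups and cocyclic pairs\<close>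

lemma generate_singleton_mono:
  assumes "x \<in> carrier G" "y \<in> generate G {x}"
  shows "generate G {y} \<subseteq> generate G {x}"
  using assms by (simp add: generate_is_subgroup generate_subgroup_incl)

lemma mem_generate_singleton:
  assumes "x \<in> carrier G"
  shows "y \<in> generate G {x} \<longleftrightarrow> (\<exists>i::int. y = x [^] i)"
  using assms by (auto simp: generate_pow)

lemma int_pow_mem_generate: "x \<in> carrier G \<Longrightarrow> x [^] (i::int) \<in> generate G {x}"
  by (auto simp: mem_generate_singleton)

lemma generate_singleton_self: "x \<in> generate G {x}"
  by (simp add: generate.incl)

lemma cyclic_subgroup_iff: "cyclic_subgroup H G \<longleftrightarrow> (\<exists>z \<in> carrier G. H = generate G {z})"
proof
  assume H: "cyclic_subgroup H G"
  then have sub: "subgroup H G"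
    by (simp add: cyclic_subgroup_def)
  interpret H: group "G\<lparr>carrier := H\<rparr>"
    using sub by (rule subgroup_imp_group)
  obtain z where "z \<in> H" "H = range (\<lambda>n::int. z [^]\<^bsub>G\<lparr>carrier := H\<rparr>\<^esub> n)"
    using H by (auto simp: cyclic_subgroup_def H.cyclic_group)
  then have "H = range (\<lambda>n::int. z [^] n)" "z \<in> carrier G"
    using sub by (simp_all add: int_pow_consistent subgroup.mem_carrier)
  then show "\<exists>z \<in> carrier G. H = generate G {z}"
    by (auto simp: generate_pow)
next
  assume "\<exists>z \<in> carrier G. H = generate G {z}"
  then obtain z where z: "z \<in> carrier G" "H = generate G {z}" ..
  then have "subgroup_generated G {z} = G\<lparr>carrier := H\<rparr>"
    by (simp add: subgroup_generated_def)
  then show "cyclic_subgroup H G"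
    using cyclic_group_generated[of z] z by (simp add: cyclic_subgroup_def generate_is_subgroup)
qed

text \<open>Asking for a common root \<open>z\<close>, rather than for <x, y> to be cyclic, lets the
  property pass to powers at once; \<open>cyclic_generated_pair_iff\<close> shows that the two agree
  on \<open>carrier G\<close>.\<close>

definition cocyclic :: "'a \<Rightarrow> 'a \<Rightarrow> bool" where
  "cocyclic x y \<longleftrightarrow> (\<exists>z \<in> carrier G. x \<in> generate G {z} \<and> y \<in> generate G {z})"

lemma cocyclicI: "z \<in> carrier G \<Longrightarrow> x \<in> generate G {z} \<Longrightarrow> y \<in> generate G {z} \<Longrightarrow> cocyclic x y"
  by (auto simp: cocyclic_def)

lemma cocyclic_sym: "cocyclic x y \<Longrightarrow> cocyclic y x"
  by (auto simp: cocyclic_def)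

lemma cocyclic_refl: "x \<in> carrier G \<Longrightarrow> cocyclic x x"
  using generate_singleton_self cocyclicI by blast

lemma cocyclic_one: "x \<in> carrier G \<Longrightarrow> cocyclic \<one> x"
  using generate_singleton_self cocyclicI generate.one by blast

lemma cocyclic_mono:
  assumes "x' \<in> carrier G" "x \<in> generate G {x'}" "cocyclic x' y"
  shows "cocyclic x y"
  using assms generate_singleton_mono by (fastforce simp: cocyclic_def)

text \<open>An arbitrary root \<open>w\<close> may generate more than <x, y>. Bezout on the
  exponents gives the root \<open>w [^] gcd i j\<close>, which is a word in \<open>x\<close> and
  \<open>y\<close> and so lies in every subgroup containing both.\<close>

lemma common_root_generator:
  assumes "w \<in> carrier G" "x \<in> generate G {w}" "y \<in> generate G {w}"
  obtains e and s t :: int where "e \<in> carrier G" "x \<in> generate G {e}" "y \<in> generate G {e}"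
    "e = x [^] s \<otimes> y [^] t"
proof -
  obtain i j :: int where ij: "x = w [^] i" "y = w [^] j"
    using assms by (auto simp: mem_generate_singleton)
  obtain s t where st: "s * i + t * j = gcd i j"
    using bezout_int by blast
  obtain i' j' where "i = gcd i j * i'" "j = gcd i j * j'"
    by (meson dvdE gcd_dvd1 gcd_dvd2)
  then have "x = (w [^] gcd i j) [^] i'" "y = (w [^] gcd i j) [^] j'"
    using assms(1) ij by (metis int_pow_pow)+
  then have "x \<in> generate G {w [^] gcd i j}" "y \<in> generate G {w [^] gcd i j}"
    using assms(1) mem_generate_singleton int_pow_closed by blast+
  moreover have "w [^] gcd i j = x [^] s \<otimes> y [^] t"
    unfolding st[symmetric] ij using assms(1) by (simp add: int_pow_pow int_pow_mult mult.commute)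
  ultimately show ?thesis
    using assms(1) that int_pow_closed by blast
qed

lemma cyclic_generated_pair_iff:
  assumes "x \<in> carrier G" "y \<in> carrier G"
  shows "cyclic_group (subgroup_generated G {x, y}) \<longleftrightarrow> cocyclic x y"
proof -
  have sub: "subgroup (generate G {x, y}) G"
    using assms by (simp add: generate_is_subgroup)
  then have *: "cyclic_group (subgroup_generated G {x, y}) \<longleftrightarrow>
      (\<exists>z \<in> carrier G. generate G {x, y} = generate G {z})"
    using assms
    by (simp add: subgroup_generated_def cyclic_subgroup_def flip: cyclic_subgroup_iff)
  have eq: "generate G {x, y} = generate G {e}"
    if "e \<in> carrier G" "x \<in> generate G {e}" "y \<in> generate G {e}"
      and e: "e = x [^] (s::int) \<otimes> y [^] (t::int)" for e s t
  proof
    show "generate G {x, y} \<subseteq> generate G {e}"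
      using that by (simp add: generate_is_subgroup generate_subgroup_incl)
    have "e \<in> generate G {x, y}"
      unfolding e using sub
      by (intro subgroup.m_closed subgroup_int_pow_closed) (auto intro: generate.incl)
    then show "generate G {e} \<subseteq> generate G {x, y}"
      using sub by (simp add: generate_subgroup_incl)
  qed
  have "\<exists>z \<in> carrier G. generate G {x, y} = generate G {z}" if xy: "cocyclic x y"
  proof -
    obtain w where "w \<in> carrier G" "x \<in> generate G {w}" "y \<in> generate G {w}"
      using xy by (auto simp: cocyclic_def)
    then obtain e and s t :: int where "e \<in> carrier G" "x \<in> generate G {e}" "y \<in> generate G {e}"
        "e = x [^] s \<otimes> y [^] t"
      by (rule common_root_generator)
    with eq show ?thesis
      by blast
  qed
  moreover have "x \<in> generate G {x, y}" "y \<in> generate G {x, y}"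
    by (auto intro: generate.incl)
  ultimately show ?thesis
    unfolding * cocyclic_def by auto
qed

section \<open>Common roots of three elements\<close>

text \<open>A finite cyclic group has just one subgroup of each order, so inside <w> the elements
  killed by \<open>ord a\<close> all lie in <a>.\<close>

lemma generate_singleton_memI:
  assumes w: "w \<in> carrier G" and "a \<in> generate G {w}" "y \<in> generate G {w}"
    and "ord w > 0" and "y [^] ord a = \<one>"
  shows "y \<in> generate G {a}"
proof -
  obtain i m :: int where im: "a = w [^] i" "y = w [^] m"
    using assms by (auto simp: mem_generate_singleton)
  define g where "g = gcd i (int (ord w))"
  have a: "a \<in> carrier G" using im w by simp
  obtain s t where st: "s * i + t * int (ord w) = g"
    using bezout_int unfolding g_def by blast
  \<comment> \<open>As \<open>w [^] g\<close> is a power of \<open>a\<close>, it suffices that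
    \<open>g\<close> divides the exponent \<open>m\<close> of \<open>y\<close>.\<close>
  have wg: "w [^] g = a [^] s"
  proof -
    have "w [^] (t * int (ord w)) = \<one>"
      using w by (simp add: int_pow_eq_id)
    then show ?thesis
      unfolding st[symmetric] im(1) using w by (simp add: int_pow_pow mult.commute int_pow_mult)
  qed
  obtain q where q: "int (ord w) = g * q"
    unfolding g_def by (meson dvdE gcd_dvd2)
  obtain i' where i': "i = g * i'"
    unfolding g_def by (meson dvdE gcd_dvd1)
  have "a [^] q = w [^] (int (ord w) * i')"
    unfolding im(1) q using w i' by (simp add: int_pow_pow ac_simps)
  also have "\<dots> = \<one>"
    using w by (simp add: int_pow_eq_id)
  finally have "int (ord a) dvd q"
    using a int_pow_eq_id by blast
  then have "g * int (ord a) dvd int (ord w)"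
    unfolding q by simp
  moreover have "int (ord w) dvd m * int (ord a)"
  proof -
    have "w [^] (m * int (ord a)) = y [^] int (ord a)"
      unfolding im using w by (simp add: int_pow_pow)
    also have "\<dots> = \<one>"
      using assms(5) by (simp add: int_pow_int)
    finally show ?thesis
      using w int_pow_eq_id by blast
  qed
  ultimately have "g * int (ord a) dvd m * int (ord a)"
    using dvd_trans by blast
  moreover have "ord a \<noteq> 0"
    using \<open>int (ord a) dvd q\<close> q assms(4) by (cases "ord a = 0") auto
  ultimately have "g dvd m"
    by simp
  then obtain r where "m = g * r" ..
  then have "y = (a [^] s) [^] r"
    using w im(2) by (simp add: int_pow_pow flip: wg)
  then show ?thesis
    using a by (auto simp: mem_generate_singleton int_pow_pow)
qed

lemma int_pow_commute:
  assumes "x \<in> carrier G" "y \<in> carrier G" "x \<otimes> y = y \<otimes> x"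
  shows "x [^] (i::int) \<otimes> y = y \<otimes> x [^] i"
proof (cases i rule: int_cases2)
  case (nonneg n)
  then show ?thesis
    using assms by (simp add: int_pow_int group_commutes_pow)
next
  case (nonpos n)
  have comm: "x [^] n \<otimes> y = y \<otimes> x [^] n"
    using assms by (simp add: group_commutes_pow)
  have "y = inv (x [^] n) \<otimes> (x [^] n \<otimes> y)"
    using assms by (simp flip: m_assoc)
  also have "\<dots> = inv (x [^] n) \<otimes> y \<otimes> x [^] n"
    using assms by (simp add: comm m_assoc)
  finally have "inv (x [^] n) \<otimes> y = y \<otimes> inv (x [^] n)"
    using assms by (simp add: inv_solve_right)
  then show ?thesis
    using assms nonpos by (simp add: int_pow_neg_int)
qed

lemma int_pow_commute2:
  assumes "x \<in> carrier G" "y \<in> carrier G" "x \<otimes> y = y \<otimes> x"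
  shows "x [^] (i::int) \<otimes> y [^] (j::int) = y [^] j \<otimes> x [^] i"
  using assms int_pow_commute[of x "y [^] j" i] int_pow_commute[of y x j] by simp

lemma commuting_common_root:
  assumes e: "e \<in> carrier G" and c: "c \<in> carrier G" and comm: "e \<otimes> c = c \<otimes> e"
    and pow: "c [^] (n::int) = e [^] (k::int)" and "n \<noteq> 0"
    and gcd: "gcd n (gcd k (int (ord e))) = 1"
  shows "cocyclic e c"
proof -
  \<comment> \<open>Changing \<open>k\<close> modulo \<open>ord e\<close>, we may take the two exponents coprime; the root \<open>z\<close> is then
    given by Bezout coefficients, with \<open>z [^] n = e\<close> and \<open>z [^] l = c\<close>.\<close>
  obtain r where "coprime n (k + r * int (ord e))"
    using ex_coprime_arith_progression[OF \<open>n \<noteq> 0\<close> gcd] by blast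
  define l where "l = k + r * int (ord e)"
  obtain s t where st: "s * n + t * l = 1"
    using \<open>coprime n (k + r * int (ord e))\<close> unfolding l_def
    by (metis bezout_int coprime_imp_gcd_eq_1)
  have l: "c [^] n = e [^] l"
    using e by (simp add: pow int_pow_eq l_def)
  define z where "z = e [^] s \<otimes> c [^] t"
  have "e [^] s \<otimes> c [^] t = c [^] t \<otimes> e [^] s"
    using e c comm by (rule int_pow_commute2)
  then have z: "z [^] i = e [^] (s * i) \<otimes> c [^] (t * i)" for i :: int
    using e c int_pow_mult_distrib[of "e [^] s" "c [^] t" i] by (simp add: z_def int_pow_pow)
  have "z [^] n = e [^] (s * n) \<otimes> (c [^] n) [^] t"
    using c by (simp add: z int_pow_pow mult.commute)
  also have "\<dots> = e [^] (s * n + t * l)"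
    unfolding l using e by (simp add: int_pow_pow int_pow_mult mult.commute)
  finally have "z [^] n = e"
    using e st by simp
  have "z [^] l = (e [^] l) [^] s \<otimes> c [^] (t * l)"
    using e by (simp add: z int_pow_pow mult.commute)
  also have "\<dots> = c [^] (s * n + t * l)"
    unfolding l[symmetric] using c by (simp add: int_pow_pow int_pow_mult mult.commute)
  finally have "z [^] l = c"
    using c st by simp
  have "z \<in> carrier G" using e c by (simp add: z_def)
  then show ?thesis
    using int_pow_mem_generate[of z n] int_pow_mem_generate[of z l]
    by (simp add: cocyclicI \<open>z [^] n = e\<close> \<open>z [^] l = c\<close>)
qed

lemma generate_singleton_commute:
  assumes "w \<in> carrier G" "x \<in> generate G {w}" "y \<in> generate G {w}"
  shows "x \<otimes> y = y \<otimes> x"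
proof -
  obtain i j :: int where "x = w [^] i" "y = w [^] j"
    using assms by (auto simp: mem_generate_singleton)
  then show ?thesis
    using assms(1) int_pow_commute2 by blast
qed

lemma pairwise_common_root:
  assumes fin: "finite (carrier G)"
    and "cocyclic a b" "cocyclic a c" "cocyclic b c"
  shows "\<exists>z \<in> carrier G. a \<in> generate G {z} \<and> b \<in> generate G {z} \<and> c \<in> generate G {z}"
proof -
  obtain u v w where uvw: "u \<in> carrier G" "a \<in> generate G {u}" "b \<in> generate G {u}"
    "v \<in> carrier G" "a \<in> generate G {v}" "c \<in> generate G {v}"
    "w \<in> carrier G" "b \<in> generate G {w}" "c \<in> generate G {w}"
    using assms(2-4) unfolding cocyclic_def by blast
  have abc: "a \<in> carrier G" "b \<in> carrier G" "c \<in> carrier G"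
    using uvw by (auto intro: generate_in_carrier[of "{_}"])
  have comm: "a \<otimes> b = b \<otimes> a" "a \<otimes> c = c \<otimes> a" "b \<otimes> c = c \<otimes> b"
    using uvw generate_singleton_commute by blast+
  obtain e and s t :: int where e: "e \<in> carrier G" "a \<in> generate G {e}" "b \<in> generate G {e}"
      and est: "e = a [^] s \<otimes> b [^] t"
    using common_root_generator[OF uvw(1-3)] by blast
  have ord_pos: "ord x > 0" if "x \<in> carrier G" for x
    using ord_ge_1[OF fin that] by simp
  have ord_e: "ord e dvd lcm (ord a) (ord b)"
  proof -
    define l where "l = lcm (ord a) (ord b)"
    have "a [^] (s * int l) = \<one>" "b [^] (t * int l) = \<one>"
      using abc by (auto simp: int_pow_eq_id l_def)
    moreover have "a [^] s \<otimes> b [^] t = b [^] t \<otimes> a [^] s"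
      using abc comm by (intro int_pow_commute2)
    ultimately have "e [^] int l = \<one>"
      using abc int_pow_mult_distrib[of "a [^] s" "b [^] t" "int l"]
      by (simp add: est int_pow_pow)
    then show ?thesis
      using e by (simp add: int_pow_int pow_eq_id l_def)
  qed
  \<comment> \<open>If \<open>c [^] m\<close> lies in <e>, its order divides \<open>g\<close>, so
    \<open>n\<close> divides \<open>m\<close>. Thus \<open>n\<close> is the least positive exponent
    that the orders permit; the next steps show that it is attained.\<close>
  define g where "g = gcd (ord c) (ord e)"
  obtain n where n: "ord c = g * n"
    unfolding g_def by (meson dvdE gcd_dvd1)
  have "n > 0" "g > 0"
    using ord_pos[of c] abc n by auto
  \<comment> \<open>The order of this power of \<open>c\<close> divides \<open>ord x\<close>, so
    inside the cyclic <z> it falls into <x>, hence into <e>. Used with \<open>x\<close> as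
    \<open>a\<close> and as \<open>b\<close>.\<close>
  have mem: "c [^] (ord c div gcd (ord c) (ord x)) \<in> generate G {e}"
    if "z \<in> carrier G" "x \<in> generate G {z}" "c \<in> generate G {z}" "x \<in> generate G {e}" for x z
  proof -
    define d where "d = gcd (ord c) (ord x)"
    have x: "x \<in> carrier G" using that by (auto intro: generate_in_carrier[of "{_}"])
    have "ord c dvd ord c div d * ord x"
      unfolding d_def by (metis dvd_div_mult dvd_triv_left gcd_dvd1 gcd_dvd2 div_mult_swap)
    then have "(c [^] (ord c div d)) [^] ord x = \<one>"
      using abc by (simp add: nat_pow_pow pow_eq_id)
    moreover have "c [^] (ord c div d) \<in> generate G {z}"
      using that subgroup_int_pow_closed[of "generate G {z}" c "int (ord c div d)"]
      by (simp add: generate_is_subgroup int_pow_int)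
    ultimately have "c [^] (ord c div d) \<in> generate G {x}"
      using that ord_pos[of z] by (blast intro: generate_singleton_memI[of z])
    then show ?thesis
      using that e generate_singleton_mono d_def by blast
  qed
  \<comment> \<open>The gcd of two exponents that send \<open>c\<close> into <e>. Both products of
    \<open>h\<close> with the gcds of orders divide \<open>ord c\<close>; so does their lcm, which
    is a multiple of \<open>h * g\<close> by distributivity.\<close>
  define h where "h = gcd (ord c div gcd (ord c) (ord a)) (ord c div gcd (ord c) (ord b))"
  have "h dvd n"
  proof -
    have "h * gcd (ord c) (ord x) dvd ord c" if "h dvd ord c div gcd (ord c) (ord x)" for x
      using that by (metis dvd_div_mult_self gcd_dvd1 mult_dvd_mono dvd_refl)
    then have "lcm (h * gcd (ord c) (ord a)) (h * gcd (ord c) (ord b)) dvd ord c"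
      by (simp add: h_def)
    also have "lcm (h * gcd (ord c) (ord a)) (h * gcd (ord c) (ord b)) =
        h * gcd (ord c) (lcm (ord a) (ord b))"
      by (simp add: lcm_mult_left gcd_lcm_distrib)
    finally have "h * g dvd ord c"
      using ord_e unfolding g_def by (meson dvd_trans gcd_mono dvd_refl mult_dvd_mono)
    then show ?thesis
      using n \<open>g > 0\<close> by (simp add: mult.commute)
  qed
  have "c [^] int n \<in> generate G {e}"
  proof -
    define p q where pq: "p = ord c div gcd (ord c) (ord a)" "q = ord c div gcd (ord c) (ord b)"
    obtain s t where st: "s * int p + t * int q = int h"
      using bezout_int[of "int p" "int q"] by (auto simp: h_def pq)
    obtain m where m: "n = h * m" using \<open>h dvd n\<close> ..
    have "int n = int p * (s * int m) + int q * (t * int m)"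
      unfolding m by (simp add: algebra_simps flip: st)
    then have "c [^] int n = (c [^] p) [^] (s * int m) \<otimes> (c [^] q) [^] (t * int m)"
      using abc by (simp add: int_pow_mult int_pow_pow flip: int_pow_int)
    moreover have "c [^] p \<in> generate G {e}" "c [^] q \<in> generate G {e}"
      using mem uvw e unfolding pq by blast+
    moreover have "subgroup (generate G {e}) G"
      using e by (simp add: generate_is_subgroup)
    ultimately show ?thesis
      by (simp add: subgroup.m_closed subgroup_int_pow_closed)
  qed
  then obtain k :: int where k: "c [^] int n = e [^] k"
    using e by (auto simp: mem_generate_singleton)
  \<comment> \<open>For a common divisor \<open>r\<close>, the power of \<open>c\<close> with
    exponent \<open>n * (ord e / r)\<close> is trivial, so \<open>g\<close> divides
    \<open>ord e / r\<close>. Then \<open>g * r\<close> divides both \<open>ord e\<close> and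
    \<open>ord c\<close>, hence \<open>g\<close>, and \<open>r\<close> is a unit.\<close>
  have "gcd (int n) (gcd k (int (ord e))) = 1"
  proof (rule ccontr)
    define r where "r = gcd (int n) (gcd k (int (ord e)))"
    assume "gcd (int n) (gcd k (int (ord e))) \<noteq> 1"
    then have "r \<noteq> 1" by (simp add: r_def)
    have "r \<ge> 0" by (simp add: r_def)
    have "r dvd int n" "r dvd k" "r dvd int (ord e)"
      unfolding r_def by (meson dvd_trans gcd_dvd1 gcd_dvd2)+
    obtain k' where k': "k = r * k'" using \<open>r dvd k\<close> ..
    obtain e' where e': "int (ord e) = r * e'" using \<open>r dvd int (ord e)\<close> ..
    have "c [^] (int n * e') = (e [^] k) [^] e'"
      using abc by (simp flip: int_pow_pow k)
    also have "\<dots> = e [^] (int (ord e) * k')"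
      unfolding e' k' using e by (simp add: int_pow_pow ac_simps)
    also have "\<dots> = \<one>"
      using e by (simp add: int_pow_eq_id)
    finally have "int g * int n dvd int n * e'"
      using abc by (simp add: int_pow_eq_id n)
    then have "int g dvd e'"
      using \<open>n > 0\<close> by (simp add: mult.commute)
    then have "int g * r dvd int (ord e)"
      unfolding e' by (simp add: mult.commute)
    moreover have "int g * r dvd int (ord c)"
      unfolding n using \<open>r dvd int n\<close> by simp
    ultimately have "int g * r dvd int g"
      unfolding g_def by (metis gcd_greatest gcd_int_int_eq)
    then have "r dvd 1"
      using \<open>g > 0\<close> by simp
    then show False
      using \<open>r \<noteq> 1\<close> \<open>r \<ge> 0\<close> by simp
  qed
  moreover have "e \<otimes> c = c \<otimes> e"
  proof -
    have *: "a [^] s \<otimes> c = c \<otimes> a [^] s" "b [^] t \<otimes> c = c \<otimes> b [^] t"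
      using abc comm by (blast intro: int_pow_commute)+
    have "e \<otimes> c = a [^] s \<otimes> (c \<otimes> b [^] t)"
      using abc * by (simp add: est m_assoc)
    also have "\<dots> = c \<otimes> e"
      using abc * by (simp add: est flip: m_assoc)
    finally show ?thesis .
  qed
  ultimately obtain z where "z \<in> carrier G" "e \<in> generate G {z}" "c \<in> generate G {z}"
    using commuting_common_root[of e c "int n" k] e abc k \<open>n > 0\<close>
    by (auto simp: cocyclic_def)
  then show ?thesis
    using e generate_singleton_mono by blast
qed

text \<open>Take \<open>x\<close> of maximal order. A common root \<open>w\<close> of
  \<open>x\<close> and \<open>y\<close> has order divisible by \<open>ord x\<close>, hence equal to
  it, so <w> = <x> contains \<open>y\<close>. This is what gives the graph of a non-cyclic group a
  vertex.\<close>

lemma all_cocyclic_imp_cyclic: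
  assumes fin: "finite (carrier G)"
    and all: "\<And>x y. x \<in> carrier G \<Longrightarrow> y \<in> carrier G \<Longrightarrow> cocyclic x y"
  shows "cyclic_group G"
proof -
  have "Max (ord ` carrier G) \<in> ord ` carrier G"
    using fin one_closed by (intro Max_in) auto
  then obtain x where x: "x \<in> carrier G" and "Max (ord ` carrier G) = ord x"
    by blast
  then have max: "ord y \<le> ord x" if "y \<in> carrier G" for y
    using fin that by (metis Max_ge finite_imageI imageI)
  have "y \<in> generate G {x}" if y: "y \<in> carrier G" for y
  proof -
    obtain w where w: "w \<in> carrier G" "x \<in> generate G {w}" "y \<in> generate G {w}"
      using all[OF x y] by (auto simp: cocyclic_def)
    then obtain i :: int where "x = w [^] i"
      by (auto simp: mem_generate_singleton)
    then have "x [^] int (ord w) = w [^] (int (ord w) * i)"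
      using w by (simp add: int_pow_pow mult.commute)
    also have "\<dots> = \<one>"
      using w by (simp add: int_pow_eq_id)
    finally have "ord x dvd ord w"
      using x by (simp add: int_pow_int pow_eq_id)
    moreover have "ord w > 0"
      using ord_ge_1[OF fin w(1)] by simp
    ultimately have "ord x = ord w"
      using max[OF w(1)] by (simp add: dvd_imp_le order_antisym)
    then have "w \<in> generate G {x}"
      using w \<open>ord w > 0\<close> generate_singleton_self generate_singleton_memI[of w x w] by simp
    then show ?thesis
      using w(3) x generate_singleton_mono by blast
  qed
  then have "carrier G = generate G {x}"
    using x by (auto intro: generate_in_carrier[of "{x}"])
  then show ?thesis
    using x by (auto simp: cyclic_group generate_pow)
qed

section \<open>The non-cyclic graph in terms of cocyclic pairs\<close>

lemma mem_pverts_noncyclic_graph: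
  "x \<in> pverts (noncyclic_graph G) \<longleftrightarrow> x \<in> carrier G \<and> (\<exists>y \<in> carrier G. \<not> cocyclic x y)"
  by (auto simp: noncyclic_graph_def Cyc_def cyclic_generated_pair_iff)

text \<open>Two elements that are not cocyclic witness for each other that they are vertices, and
  they are distinct by reflexivity.\<close>

lemma mem_parcs_noncyclic_graph:
  "(x, y) \<in> parcs (noncyclic_graph G) \<longleftrightarrow> x \<in> carrier G \<and> y \<in> carrier G \<and> \<not> cocyclic x y"
proof -
  have "(x, y) \<in> parcs (noncyclic_graph G) \<longleftrightarrow> x \<in> carrier G \<and> y \<in> carrier G \<and>
      (\<exists>z \<in> carrier G. \<not> cocyclic x z) \<and> (\<exists>z \<in> carrier G. \<not> cocyclic y z) \<and>
      x \<noteq> y \<and> \<not> cocyclic x y"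
    by (auto simp: noncyclic_graph_def Cyc_def cyclic_generated_pair_iff)
  then show ?thesis
    using cocyclic_sym cocyclic_refl by blast
qed

lemma dominating_vertex_noncyclic_graph_iff:
  "dominating_vertex (noncyclic_graph G) v \<longleftrightarrow> v \<in> pverts (noncyclic_graph G) \<and>
    (\<forall>u \<in> pverts (noncyclic_graph G). cocyclic v u \<longrightarrow> u = v)"
  by (auto simp: dominating_vertex_def mem_pverts_noncyclic_graph mem_parcs_noncyclic_graph)

lemma perfect_code_singleton:
  assumes "dominating_vertex (noncyclic_graph G) v"
  shows "perfect_code (noncyclic_graph G) {v}"
  using assms cocyclic_refl
  by (auto simp: dominating_vertex_noncyclic_graph_iff perfect_code_def independent_set_def
      mem_parcs_noncyclic_graph mem_pverts_noncyclic_graph dest: cocyclic_sym)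

section \<open>Perfect codes have at most one element\<close>

lemma perfect_code_subsingleton:
  assumes fin: "finite (carrier G)" and C: "perfect_code (noncyclic_graph G) C"
    and cd: "c \<in> C" "d \<in> C"
  shows "c = d"
proof (rule ccontr)
  assume "c \<noteq> d"
  have V: "\<And>x. x \<in> C \<Longrightarrow> x \<in> pverts (noncyclic_graph G)"
    and indep: "\<And>x y. x \<in> C \<Longrightarrow> y \<in> C \<Longrightarrow> cocyclic x y"
    using C unfolding perfect_code_def independent_set_def mem_parcs_noncyclic_graph
    by (auto simp: subset_iff mem_pverts_noncyclic_graph)
  have dom: "\<exists>!x. x \<in> C \<and> \<not> cocyclic y x" if "y \<in> pverts (noncyclic_graph G)" "y \<notin> C" for y
  proof -
    have "(y, x) \<in> parcs (noncyclic_graph G) \<longleftrightarrow> \<not> cocyclic y x" if "x \<in> C" for x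
      using that V \<open>y \<in> pverts _\<close> by (auto simp: mem_parcs_noncyclic_graph mem_pverts_noncyclic_graph)
    then show ?thesis
      using C that unfolding perfect_code_def by (smt (verit) DiffI)
  qed
  obtain w where "w \<in> carrier G" "c \<in> generate G {w}" "d \<in> generate G {w}"
    using indep[OF cd] by (auto simp: cocyclic_def)
  then obtain e and s t :: int where e: "e \<in> carrier G" "c \<in> generate G {e}" "d \<in> generate G {e}"
      and est: "e = c [^] s \<otimes> d [^] t"
    using common_root_generator by blast
  obtain y where y: "y \<in> carrier G" "\<not> cocyclic c y"
    using V[OF cd(1)] by (auto simp: mem_pverts_noncyclic_graph)
  have "\<not> cocyclic e y"
    using y e cocyclic_mono by blast
  show False
  proof (cases "e \<in> C")
    case True
    \<comment> \<open>A neighbour \<open>y\<close> of \<open>x\<close> lies outside the code, whose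
      members are pairwise cocyclic, and is also adjacent to \<open>e\<close>; uniqueness identifies
      \<open>x\<close> with \<open>e\<close>. This applies to both \<open>c\<close> and
      \<open>d\<close>.\<close>
    have "x = e" if x: "x \<in> C" "x \<in> generate G {e}" for x
    proof -
      obtain y where y: "y \<in> carrier G" "\<not> cocyclic x y"
        using V[OF x(1)] by (auto simp: mem_pverts_noncyclic_graph)
      then have "\<not> cocyclic e y" "y \<notin> C"
        using e x cocyclic_mono indep by blast+
      moreover have "y \<in> pverts (noncyclic_graph G)"
        using V[OF x(1)] y by (auto simp: mem_pverts_noncyclic_graph dest: cocyclic_sym)
      ultimately show ?thesis
        using dom[of y] True x y cocyclic_sym by blast
    qed
    then show False
      using \<open>c \<noteq> d\<close> cd e by blast
  next
    case False
    have "e \<in> pverts (noncyclic_graph G)"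
      using e y \<open>\<not> cocyclic e y\<close> by (auto simp: mem_pverts_noncyclic_graph)
    then obtain x where x: "x \<in> C" "\<not> cocyclic e x"
      using dom False by blast
    \<comment> \<open>Being a word in \<open>c\<close> and \<open>d\<close>, \<open>e\<close> also
      lies in <z>, which makes it cocyclic with \<open>x\<close>.\<close>
    obtain z where z: "z \<in> carrier G" "c \<in> generate G {z}" "d \<in> generate G {z}" "x \<in> generate G {z}"
      using pairwise_common_root[OF fin] indep cd x by blast
    have "subgroup (generate G {z}) G"
      using z(1) by (simp add: generate_is_subgroup)
    then have "e \<in> generate G {z}"
      unfolding est using z by (simp add: subgroup.m_closed subgroup_int_pow_closed)
    then show False
      using x z cocyclicI by blast
  qed
qed

section \<open>Dominating vertices and maximal cyclic subgroups\<close>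

lemma dominating_vertex_imp_maximal_cyclic:
  assumes v: "dominating_vertex (noncyclic_graph G) v"
  shows "maximal_cyclic_subgroup (generate G {v}) G" and "card (generate G {v}) = 2"
proof -
  have vG: "v \<in> carrier G" and vV: "\<exists>y \<in> carrier G. \<not> cocyclic v y"
    using v by (auto simp: dominating_vertex_noncyclic_graph_iff mem_pverts_noncyclic_graph)
  \<comment> \<open>A root \<open>z\<close> of \<open>v\<close> inherits from \<open>v\<close> an
    element with which it is not cocyclic, so it is a vertex, yet it is not adjacent to
    \<open>v\<close>. Taking \<open>z = inv v\<close> below shows that \<open>v\<close> is its own
    inverse.\<close>
  have only: "z = v" if z: "z \<in> carrier G" "v \<in> generate G {z}" for z
  proof -
    have "z \<in> pverts (noncyclic_graph G)"
      using vV z cocyclic_mono by (auto simp: mem_pverts_noncyclic_graph)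
    moreover have "cocyclic v z"
      using z cocyclicI generate_singleton_self by blast
    ultimately show ?thesis
      using v by (auto simp: dominating_vertex_noncyclic_graph_iff)
  qed
  then show "maximal_cyclic_subgroup (generate G {v}) G"
    using vG generate_singleton_self by (auto simp: maximal_cyclic_subgroup_def cyclic_subgroup_iff)
  have "v \<noteq> \<one>"
    using vV cocyclic_one by auto
  have "v \<in> generate G {inv v}"
    using generate.inv[of "inv v" "{inv v}" G] vG by simp
  then have "inv v = v"
    using only vG by simp
  have "generate G {v} = {\<one>, v}"
  proof
    have "v \<otimes> v = \<one>"
      using vG \<open>inv v = v\<close> by (metis r_inv)
    then have "subgroup {\<one>, v} G"
      using vG \<open>inv v = v\<close> by (auto simp: subgroup_def)
    then show "generate G {v} \<subseteq> {\<one>, v}"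
      by (rule generate_subgroup_incl[rotated]) simp
  qed (simp add: generate.one generate_singleton_self)
  then show "card (generate G {v}) = 2"
    using \<open>v \<noteq> \<one>\<close> by simp
qed

text \<open>By maximality every root of the generator \<open>v\<close> generates \<open>H\<close>,
  so whatever is cocyclic with \<open>v\<close> lies in \<open>{\<one>, v}\<close>; and the identity
  is not a vertex.\<close>

lemma maximal_cyclic_imp_dominating_vertex:
  assumes nc: "\<not> cyclic_group G" and H: "maximal_cyclic_subgroup H G" "card H = 2"
  shows "\<exists>v. dominating_vertex (noncyclic_graph G) v"
proof -
  obtain v where v: "v \<in> carrier G" "H = generate G {v}"
    using H by (auto simp: maximal_cyclic_subgroup_def cyclic_subgroup_iff)
  have max: "generate G {z} = H" if "z \<in> carrier G" "v \<in> generate G {z}" for z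
  proof -
    have "\<not> H \<subset> generate G {z}"
      using H(1) that(1) unfolding maximal_cyclic_subgroup_def cyclic_subgroup_iff by blast
    then show ?thesis
      using generate_singleton_mono[OF that] v(2) by blast
  qed
  have *: "u \<in> H" if "cocyclic v u" for u
    using that max by (auto simp: cocyclic_def)
  have "v \<noteq> \<one>"
    using H(2) v generate_one by auto
  then have "card {\<one>, v} = card H"
    using H(2) by simp
  moreover have "{\<one>, v} \<subseteq> H" "finite H"
    using H(2) v generate.one generate_singleton_self by (auto intro: card_ge_0_finite)
  ultimately have Hv: "H = {\<one>, v}"
    by (metis card_subset_eq)
  \<comment> \<open>Here non-cyclicity enters: otherwise \<open>H\<close> would be all of
    \<open>G\<close>, and \<open>v\<close> would not be a vertex.\<close>
  have "\<exists>y \<in> carrier G. \<not> cocyclic v y"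
  proof (rule ccontr)
    assume "\<not> (\<exists>y \<in> carrier G. \<not> cocyclic v y)"
    then have "carrier G = generate G {v}"
      using * v by (auto intro: generate_in_carrier[of "{v}"])
    then show False
      using nc v by (auto simp: cyclic_group generate_pow)
  qed
  moreover have "u = v" if "cocyclic v u" "u \<in> pverts (noncyclic_graph G)" for u
    using *[OF that(1)] that(2) cocyclic_one by (auto simp: Hv mem_pverts_noncyclic_graph)
  ultimately have "dominating_vertex (noncyclic_graph G) v"
    using v(1) by (simp add: dominating_vertex_noncyclic_graph_iff mem_pverts_noncyclic_graph)
  then show ?thesis ..
qed

end

theorem theorem4p2:
  fixes G :: "('a, 'b) monoid_scheme"
  assumes "group G" and "finite (carrier G)" and "\<not> cyclic_group G"
  shows "((\<exists>C. perfect_code (noncyclic_graph G) C) \<longleftrightarrow>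
          (\<exists>v. dominating_vertex (noncyclic_graph G) v)) \<and>
         ((\<exists>v. dominating_vertex (noncyclic_graph G) v) \<longleftrightarrow>
          (\<exists>H. maximal_cyclic_subgroup H G \<and> card H = 2))"
proof -
  interpret group G by fact
  have "\<exists>v. dominating_vertex (noncyclic_graph G) v" if C: "perfect_code (noncyclic_graph G) C" for C
  proof -
    \<comment> \<open>The empty set is no perfect code, since it would leave this vertex without a
      neighbour in the code.\<close>
    obtain x where x: "x \<in> pverts (noncyclic_graph G)"
      using all_cocyclic_imp_cyclic assms(2,3) by (auto simp: mem_pverts_noncyclic_graph)
    then have "C \<noteq> {}"
      using C by (auto simp: perfect_code_def)
    then obtain v where "C = {v}"
      using perfect_code_subsingleton[OF assms(2) C] by blast
    then have "dominating_vertex (noncyclic_graph G) v"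
      using C
      by (auto simp: dominating_vertex_noncyclic_graph_iff perfect_code_def independent_set_def
          mem_parcs_noncyclic_graph dest: cocyclic_sym)
    then show ?thesis ..
  qed
  then show ?thesis
    using perfect_code_singleton dominating_vertex_imp_maximal_cyclic
      maximal_cyclic_imp_dominating_vertex[OF assms(3)] by blast
qed

end
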